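(* If both components of the pairs $(G,U)\in\mathrm{Obj}(\mathcal{G}_f)$ are restricted to Hopfian groups (that is, only pairs with $G$ and $U$ Hopfian are considered), then the pre-order of transfer kernels $\ker(T_{G,U})\preceq\ker(T_{H,V})$ is a partial order: it is reflexive, transitive, and antisymmetric, i.e. $\ker(T_{G,U})\preceq\ker(T_{H,V})$ and $\ker(T_{H,V})\preceq\ker(T_{G,U})$ imply $\ker(T_{G,U})=\ker(T_{H,V})$ in the sense of equality of transfer kernels.
   Context: A group $X$ is Hopfian if every epimorphism $X\to X$ is an isomorphism. $X'=[X,X]$. For a group $G$ and a subgroup $U\le G$ of finite index $n$ with left transversal $(\ell_1,\ldots,\ell_n)$, each $x\in G$ determines $\lambda_x\in S_n$ with $x\ell_iU=\ell_{\lambda_x(i)}U$. The Artin transfer is the homomorphism $T_{G,U}:G\to U/U'$, $T_{G,U}(x)=\prod_{i=1}^n \ell_{\lambda_x(i)}^{-1}x\ell_i\cdot U'$, independent of the transversal. The category $\mathcal{G}_f$ has as objects the pairs $(G,U)$ of a group $G$ and a subgroup $U\le G$ of finite index, and as morphisms $\varphi:(G,U)\to(H,V)$ the epimorphisms $\varphi:G\to H$ with $\varphi(G)=H$, $\varphi(U)=V$ and $\ker(\varphi)\le U$. Such a morphism induces an epimorphism $\tilde\varphi:U/U'\to V/V'$, $xU'\mapsto\varphi(x)V'$. The transfer kernel $\ker(T_{G,U})$ is regarded as attached to the pair $(G,U)$. Precedence $\ker(T_{G,U})\preceq\ker(T_{H,V})$ means that there is a morphism $\varphi:(G,U)\to(H,V)$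 with $\varphi(\ker(T_{G,U}))\le\ker(T_{H,V})$. Equality $\ker(T_{G,U})=\ker(T_{H,V})$ means that there is a morphism $\varphi:(G,U)\to(H,V)$ for which $\varphi(\ker(T_{G,U}))=\ker(T_{H,V})$ and the induced epimorphism $\tilde\varphi$ is an isomorphism. *)

theory Defs
  imports "HOL-Algebra.Algebra"
begin

definition hopfian :: "('a, 'm) monoid_scheme \<Rightarrow> bool" where
  "hopfian G \<longleftrightarrow> group G \<and> epi G G \<subseteq> iso G G"

abbreviation sub_group :: "('a, 'm) monoid_scheme \<Rightarrow> 'a set \<Rightarrow> ('a, 'm) monoid_scheme" where
  "sub_group G U \<equiv> G\<lparr>carrier := U\<rparr>"

(* U/U', with U' the derived subgroup of the group U itself. The elements of a quotient "Mod" are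
   right cosets; since U' is normal in U they coincide with the left cosets xU'. *)
abbreviation sub_derived :: "('a, 'm) monoid_scheme \<Rightarrow> 'a set \<Rightarrow> 'a set" where
  "sub_derived G U \<equiv> derived (sub_group G U) U"

abbreviation abelianization :: "('a, 'm) monoid_scheme \<Rightarrow> 'a set \<Rightarrow> 'a set monoid" where
  "abelianization G U \<equiv> sub_group G U Mod sub_derived G U"

abbreviation lindex :: "('a, 'm) monoid_scheme \<Rightarrow> 'a set \<Rightarrow> nat" where
  "lindex G U \<equiv> card (lcosets\<^bsub>G\<^esub> U)"

definition Gf_obj :: "('a, 'm) monoid_scheme \<Rightarrow> 'a set \<Rightarrow> bool" where
  "Gf_obj G U \<longleftrightarrow> group G \<and> subgroup U G \<and> finite (lcosets\<^bsub>G\<^esub> U)"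

definition Gf_mor ::
  "('a, 'm) monoid_scheme \<Rightarrow> 'a set \<Rightarrow> ('b, 'n) monoid_scheme \<Rightarrow> 'b set \<Rightarrow> ('a \<Rightarrow> 'b) \<Rightarrow> bool" where
  "Gf_mor G U H V \<phi> \<longleftrightarrow>
     Gf_obj G U \<and> Gf_obj H V \<and> \<phi> \<in> epi G H \<and> \<phi> ` U = V \<and> kernel G H \<phi> \<subseteq> U"

(* xU' \<mapsto> \<phi>(x)V'; the image set is a singleton as \<phi> maps U' into V'. *)
definition induced ::
  "('a, 'm) monoid_scheme \<Rightarrow> 'a set \<Rightarrow> ('b, 'n) monoid_scheme \<Rightarrow> 'b set \<Rightarrow> ('a \<Rightarrow> 'b)
     \<Rightarrow> 'a set \<Rightarrow> 'b set" where
  "induced G U H V \<phi> C =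
     the_elem ((\<lambda>x. sub_derived H V #>\<^bsub>sub_group H V\<^esub> \<phi> x) ` C)"

definition left_transversal ::
  "('a, 'm) monoid_scheme \<Rightarrow> 'a set \<Rightarrow> (nat \<Rightarrow> 'a) \<Rightarrow> bool" where
  "left_transversal G U l \<longleftrightarrow>
     l \<in> {1..lindex G U} \<rightarrow> carrier G \<and>
     bij_betw (\<lambda>i. l i <#\<^bsub>G\<^esub> U) {1..lindex G U} (lcosets\<^bsub>G\<^esub> U)"

definition transversal_perm ::
  "('a, 'm) monoid_scheme \<Rightarrow> 'a set \<Rightarrow> (nat \<Rightarrow> 'a) \<Rightarrow> 'a \<Rightarrow> nat \<Rightarrow> nat" where
  "transversal_perm G U l x i =
     (THE j. j \<in> {1..lindex G U} \<and> (x \<otimes>\<^bsub>G\<^esub> l i) <#\<^bsub>G\<^esub> U = l j <#\<^bsub>G\<^esub> U)"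

definition transfer_wrt ::
  "('a, 'm) monoid_scheme \<Rightarrow> 'a set \<Rightarrow> (nat \<Rightarrow> 'a) \<Rightarrow> 'a \<Rightarrow> 'a set" where
  "transfer_wrt G U l x =
     sub_derived G U #>\<^bsub>sub_group G U\<^esub>
       foldr (\<lambda>i y. (inv\<^bsub>G\<^esub> (l (transversal_perm G U l x i)) \<otimes>\<^bsub>G\<^esub> x \<otimes>\<^bsub>G\<^esub> l i) \<otimes>\<^bsub>G\<^esub> y)
         [1..<Suc (lindex G U)] \<one>\<^bsub>G\<^esub>"

(* The value does not depend on the transversal, so an arbitrary one is chosen. *)
definition artin_transfer ::
  "('a, 'm) monoid_scheme \<Rightarrow> 'a set \<Rightarrow> 'a \<Rightarrow> 'a set" where
  "artin_transfer G U = transfer_wrt G U (SOME l. left_transversal G U l)"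

definition transfer_kernel :: "('a, 'm) monoid_scheme \<Rightarrow> 'a set \<Rightarrow> 'a set" where
  "transfer_kernel G U = kernel G (abelianization G U) (artin_transfer G U)"

(* Both relations below compare transfer kernels as attached to their pairs, hence are relations
   between pairs. The groups may live over different types. *)
definition tk_prec ::
  "('a, 'm) monoid_scheme \<Rightarrow> 'a set \<Rightarrow> ('b, 'n) monoid_scheme \<Rightarrow> 'b set \<Rightarrow> bool" where
  "tk_prec G U H V \<longleftrightarrow>
     (\<exists>\<phi>. Gf_mor G U H V \<phi> \<and> \<phi> ` transfer_kernel G U \<subseteq> transfer_kernel H V)"

definition tk_equal ::
  "('a, 'm) monoid_scheme \<Rightarrow> 'a set \<Rightarrow> ('b, 'n) monoid_scheme \<Rightarrow> 'b set \<Rightarrow> bool" where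
  "tk_equal G U H V \<longleftrightarrow>
     (\<exists>\<phi>. Gf_mor G U H V \<phi> \<and> \<phi> ` transfer_kernel G U = transfer_kernel H V \<and>
        induced G U H V \<phi> \<in> iso (abelianization G U) (abelianization H V))"

definition hopfian_obj :: "('a, 'm) monoid_scheme \<Rightarrow> 'a set \<Rightarrow> bool" where
  "hopfian_obj G U \<longleftrightarrow> Gf_obj G U \<and> hopfian G \<and> hopfian (sub_group G U)"

end

theory Submission
  imports Defs
begin

text \<open>Identities are morphisms, and composites of morphisms are morphisms: if \<open>\<psi>(\<phi>(x)) = 1\<close> then
  \<open>\<phi>(x) \<in> ker \<psi> \<subseteq> V = \<phi>(U)\<close>, so \<open>x\<close> lies in \<open>U ker \<phi> = U\<close>. This gives reflexivity and
  transitivity.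

  For antisymmetry, morphisms \<open>\<phi> : (G,U) \<rightarrow> (H,V)\<close> and \<open>\<psi> : (H,V) \<rightarrow> (G,U)\<close> compose to an
  epimorphism \<open>\<psi> \<circ> \<phi>\<close> of the Hopfian group \<open>G\<close> onto itself. It is therefore injective, and so
  \<open>\<phi>\<close> is an isomorphism \<open>G \<rightarrow> H\<close> with \<open>\<phi>(U) = V\<close> (\<open>Gf_mor_hopfian_iso\<close>). Such a \<open>\<phi>\<close> carries
  all structure built from \<open>(G,U)\<close> to that built from \<open>(H,V)\<close>; in particular it induces an
  isomorphism \<open>U/U' \<rightarrow> V/V'\<close> (\<open>induced_iso\<close>) and maps one transfer kernel onto the other
  (\<open>iso_transfer_kernel\<close>).

  The last point has content, since the transfer is defined through an arbitrarily chosen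
  transversal, and the choice for \<open>(H,V)\<close> need not be the \<open>\<phi>\<close>-image of the choice for \<open>(G,U)\<close>. The
  main work is thus the independence of the transfer from the transversal
  (\<open>transfer_wrt_unique\<close>). Nor can the two inclusions
  \<open>\<phi>(ker T\<^bsub>G,U\<^esub>) \<subseteq> ker T\<^bsub>H,V\<^esub>\<close> and \<open>\<psi>(ker T\<^bsub>H,V\<^esub>) \<subseteq> ker T\<^bsub>G,U\<^esub>\<close> alone replace this argument: an
  injective homomorphism may map an infinite subgroup onto a proper subgroup of itself.\<close>

section \<open>Abelianisations of subgroups\<close>

lemma hom_to_abelianization:
  assumes "group G" "subgroup U G"
  shows "group_hom (sub_group G U) (abelianization G U)
           (\<lambda>u. sub_derived G U #>\<^bsub>sub_group G U\<^esub> u)"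
    and "comm_group (abelianization G U)"
proof -
  interpret U: group "sub_group G U"
    using assms by (simp add: group.subgroup_imp_group)
  have norm: "sub_derived G U \<lhd> sub_group G U"
    using U.derived_self_is_normal by simp
  show com: "comm_group (abelianization G U)"
    using U.derived_quot_is_comm_group by simp
  show "group_hom (sub_group G U) (abelianization G U)
          (\<lambda>u. sub_derived G U #>\<^bsub>sub_group G U\<^esub> u)"
    using normal.r_coset_hom_Mod[OF norm] U.is_group com
    by (simp add: group_hom_def group_hom_axioms_def comm_group_def)
qed

lemma kernel_to_abelianization:
  assumes "group G" "subgroup U G" "u \<in> U"
  shows "sub_derived G U #>\<^bsub>sub_group G U\<^esub> u = sub_derived G U \<longleftrightarrow> u \<in> sub_derived G U"
proof -
  interpret U: group "sub_group G U"
    using assms by (simp add: group.subgroup_imp_group)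
  have sg: "subgroup (sub_derived G U) (sub_group G U)"
    by (rule U.derived_is_subgroup) simp
  show ?thesis
  proof
    assume "sub_derived G U #>\<^bsub>sub_group G U\<^esub> u = sub_derived G U"
    then show "u \<in> sub_derived G U"
      using U.rcos_self[OF _ sg, of u] assms(3) by simp
  next
    assume "u \<in> sub_derived G U"
    then show "sub_derived G U #>\<^bsub>sub_group G U\<^esub> u = sub_derived G U"
      using U.coset_join2[OF _ sg, of u] assms(3) by simp
  qed
qed

lemma hom_restrict:
  assumes "\<phi> \<in> hom G H" "group G" "group H" "subgroup U G" "subgroup (\<phi> ` U) H"
  shows "group_hom (sub_group G U) (sub_group H (\<phi> ` U)) \<phi>"
  using assms subgroup.subset[OF assms(4)]
  by (auto simp: group_hom_def group_hom_axioms_def hom_def group.subgroup_imp_group subset_iff)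

lemma image_sub_derived:
  assumes "\<phi> \<in> hom G H" "group G" "group H" "subgroup U G" "subgroup (\<phi> ` U) H"
  shows "\<phi> ` sub_derived G U = sub_derived H (\<phi> ` U)"
  using group_hom.derived_img[OF hom_restrict[OF assms], of U] by simp

text \<open>The map \<open>u \<mapsto> V'\<phi>(u)\<close> is an epimorphism of \<open>U\<close> onto \<open>V/V'\<close> with kernel \<open>U'\<close>, and the induced
  map is exactly the one given by the first isomorphism theorem.\<close>

lemma induced_iso:
  assumes iso: "\<phi> \<in> iso G H" and "group G" "group H" "subgroup U G" and V: "\<phi> ` U = V"
    and "subgroup V H"
  shows "induced G U H V \<phi> \<in> iso (abelianization G U) (abelianization H V)"
proof -
  have hom: "\<phi> \<in> hom G H" and inj: "inj_on \<phi> (carrier G)"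
    using iso by (auto simp: iso_def bij_betw_def)
  have UG: "U \<subseteq> carrier G"
    using assms by (simp add: subgroup.subset)
  define h where "h = (\<lambda>x. sub_derived H V #>\<^bsub>sub_group H V\<^esub> \<phi> x)"
  interpret r: group_hom "sub_group G U" "sub_group H V" \<phi>
    using hom_restrict[OF hom \<open>group G\<close> \<open>group H\<close> \<open>subgroup U G\<close>] \<open>subgroup V H\<close>
    unfolding V by simp
  interpret p: group_hom "sub_group H V" "abelianization H V"
      "\<lambda>u. sub_derived H V #>\<^bsub>sub_group H V\<^esub> u"
    by (rule hom_to_abelianization) fact+
  have "h \<in> hom (sub_group G U) (abelianization H V)"
    using Group.hom_compose[OF r.homh p.homh] by (simp add: h_def o_def)
  then interpret h: group_hom "sub_group G U" "abelianization H V" h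
    by unfold_locales
  have sdU: "sub_derived G U \<subseteq> U"
    using r.G.derived_in_carrier[of U] by simp
  have im: "sub_derived H V = \<phi> ` sub_derived G U"
    using image_sub_derived[OF hom] assms by simp
  \<comment> \<open>Injectivity of \<open>\<phi>\<close> makes \<open>U'\<close> the full preimage of \<open>V'\<close>.\<close>
  have "kernel (sub_group G U) (abelianization H V) h = {u \<in> U. \<phi> u \<in> sub_derived H V}"
    using kernel_to_abelianization[OF \<open>group H\<close> \<open>subgroup V H\<close>] V
    by (auto simp: kernel_def h_def FactGroup_def)
  also have "\<dots> = sub_derived G U"
    using im inj sdU UG by (auto dest!: inj_onD)
  finally have ker: "kernel (sub_group G U) (abelianization H V) h = sub_derived G U" .
  have "h ` carrier (sub_group G U) = carrier (abelianization H V)"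
    using V by (auto simp: h_def FactGroup_def RCOSETS_def)
  from h.FactGroup_iso_set[OF this] show ?thesis
    unfolding ker unfolding h_def induced_def[abs_def] .
qed

section \<open>The transfer does not depend on the transversal\<close>

text \<open>A function \<open>r\<close> choosing an element of each left coset is a transversal indexed by the cosets
  themselves. With this indexing the permutation \<open>\<lambda>\<^sub>x\<close> becomes left translation of cosets by \<open>x\<close>,
  and the product can be taken over the unordered set of cosets.\<close>

definition section_transfer ::
  "('a, 'm) monoid_scheme \<Rightarrow> 'a set \<Rightarrow> ('a set \<Rightarrow> 'a) \<Rightarrow> 'a \<Rightarrow> 'a set" where
  "section_transfer G U r x =
     finprod (abelianization G U)
       (\<lambda>C. sub_derived G U #>\<^bsub>sub_group G U\<^esub> (inv\<^bsub>G\<^esub> r (x <#\<^bsub>G\<^esub> C) \<otimes>\<^bsub>G\<^esub> x \<otimes>\<^bsub>G\<^esub> r C))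
       (lcosets\<^bsub>G\<^esub> U)"

lemma (in group) lcoset_translate:
  assumes "subgroup U G" "x \<in> carrier G" "a \<in> carrier G"
  shows "x <# (a <# U) = (x \<otimes> a) <# U"
  using assms lcos_m_assoc subgroup.subset by blast

lemma (in group) lcoset_translate_closed:
  assumes "subgroup U G" "x \<in> carrier G" "C \<in> lcosets U"
  shows "x <# C \<in> lcosets U"
  using assms lcoset_translate by (auto simp: LCOSETS_def)

lemma (in group) bij_lcoset_translate:
  assumes U: "subgroup U G" and x: "x \<in> carrier G"
  shows "bij_betw (\<lambda>C. x <#\<^bsub>G\<^esub> C) (lcosets U) (lcosets U)"
proof (rule bij_betw_byWitness[where f' = "\<lambda>C. inv x <# C"])
  have "y <# (z <# C) = C" if "y \<otimes> z = \<one>" "y \<in> carrier G" "z \<in> carrier G" "C \<in> lcosets U"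
    for y z C
  proof -
    have "C \<subseteq> carrier G"
      using that(4) U lcosets_subset_PowG by blast
    then show ?thesis
      using that by (simp add: lcos_m_assoc lcos_mult_one)
  qed
  then show "\<forall>C\<in>lcosets U. inv x <# (x <# C) = C" "\<forall>C\<in>lcosets U. x <# (inv x <# C) = C"
    using x by simp_all
qed (use assms lcoset_translate_closed in auto)

lemma (in group) lcoset_quotient:
  assumes U: "subgroup U G" and C: "C \<in> lcosets U" and "a \<in> C" "b \<in> C"
  shows "inv a \<otimes> b \<in> U"
proof -
  obtain c u v where c: "c \<in> carrier G" "u \<in> U" "v \<in> U" "a = c \<otimes> u" "b = c \<otimes> v"
    using assms by (auto simp: LCOSETS_def l_coset_def)
  note [simp] = subgroup.mem_carrier[OF U]
  have "inv a \<otimes> b = inv u \<otimes> v"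
    using c by (simp add: inv_mult_group m_assoc inv_solve_left')
  then show ?thesis
    using c U by (simp add: subgroup.m_closed subgroup.m_inv_closed)
qed

lemma (in group) transfer_factor_closed:
  assumes U: "subgroup U G" and x: "x \<in> carrier G"
    and r: "\<And>C. C \<in> lcosets U \<Longrightarrow> r C \<in> C" and C: "C \<in> lcosets U"
  shows "inv r (x <#\<^bsub>G\<^esub> C) \<otimes> x \<otimes> r C \<in> U"
proof -
  have xC: "x <# C \<in> lcosets U"
    using U x C by (rule lcoset_translate_closed)
  have sub: "D \<in> lcosets U \<Longrightarrow> D \<subseteq> carrier G" for D
    using U lcosets_subset_PowG by blast
  have "x \<otimes> r C \<in> x <# C"
    using r[OF C] by (auto simp: l_coset_def)
  from lcoset_quotient[OF U xC r[OF xC] this] show ?thesis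
    using r[OF C] r[OF xC] sub[OF C] sub[OF xC] x by (simp add: m_assoc subset_iff)
qed

text \<open>Two sections differ by \<open>u C = r(C)\<^sup>-\<^sup>1 s(C) \<in> U\<close>, and
  \<open>u(xC) \<cdot> s(xC)\<^sup>-\<^sup>1 x s(C) = r(xC)\<^sup>-\<^sup>1 x r(C) \<cdot> u(C)\<close>. Multiplied over all cosets \<open>C\<close> in the
  commutative group \<open>U/U'\<close>, the corrections \<open>u(xC)\<close> and \<open>u(C)\<close> have the same product, because
  translation by \<open>x\<close> permutes the cosets.\<close>

lemma section_transfer_unique:
  assumes "group G" and U: "subgroup U G" and x: "x \<in> carrier G"
    and r: "\<And>C. C \<in> lcosets\<^bsub>G\<^esub> U \<Longrightarrow> r C \<in> C" and s: "\<And>C. C \<in> lcosets\<^bsub>G\<^esub> U \<Longrightarrow> s C \<in> C"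
  shows "section_transfer G U r x = section_transfer G U s x"
proof -
  interpret G: group G by fact
  let ?A = "abelianization G U" and ?L = "lcosets\<^bsub>G\<^esub> U"
  define p where "p = (\<lambda>u. sub_derived G U #>\<^bsub>sub_group G U\<^esub> u)"
  interpret p: group_hom "sub_group G U" ?A p
    unfolding p_def by (rule hom_to_abelianization) fact+
  interpret A: comm_group ?A
    by (rule hom_to_abelianization) fact+
  have p_mult: "p (u \<otimes>\<^bsub>G\<^esub> v) = p u \<otimes>\<^bsub>?A\<^esub> p v" if "u \<in> U" "v \<in> U" for u v
    using p.hom_mult[of u v] that by simp
  have p_closed: "p u \<in> carrier ?A" if "u \<in> U" for u
    using p.hom_closed[of u] that by simp
  define f where "f r C = inv\<^bsub>G\<^esub> r (x <#\<^bsub>G\<^esub> C) \<otimes>\<^bsub>G\<^esub> x \<otimes>\<^bsub>G\<^esub> r C" for r C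
  define u where "u C = inv\<^bsub>G\<^esub> r C \<otimes>\<^bsub>G\<^esub> s C" for C
  have fr: "f r C \<in> U" and fs: "f s C \<in> U" and uU: "u C \<in> U"
    and xC: "x <#\<^bsub>G\<^esub> C \<in> ?L" and rG: "r C \<in> carrier G" and sG: "s C \<in> carrier G"
    if C: "C \<in> ?L" for C
  proof -
    show "f r C \<in> U" "f s C \<in> U"
      unfolding f_def by (rule G.transfer_factor_closed; use U x r s C in auto)+
    show "u C \<in> U"
      unfolding u_def using G.lcoset_quotient[OF U C] r s C by simp
    show "x <#\<^bsub>G\<^esub> C \<in> ?L"
      by (rule G.lcoset_translate_closed) fact+
    show "r C \<in> carrier G" "s C \<in> carrier G"
      using r[OF C] s[OF C] C U G.lcosets_subset_PowG by blast+
  qed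
  have rel: "p (u (x <#\<^bsub>G\<^esub> C)) \<otimes>\<^bsub>?A\<^esub> p (f s C) = p (f r C) \<otimes>\<^bsub>?A\<^esub> p (u C)"
    if C: "C \<in> ?L" for C
  proof -
    have cancel: "a \<otimes>\<^bsub>G\<^esub> (inv\<^bsub>G\<^esub> a \<otimes>\<^bsub>G\<^esub> b) = b"
      if "a \<in> carrier G" "b \<in> carrier G" for a b
      using that by (simp flip: G.m_assoc)
    have eq: "u (x <#\<^bsub>G\<^esub> C) \<otimes>\<^bsub>G\<^esub> f s C = f r C \<otimes>\<^bsub>G\<^esub> u C"
      using C xC rG sG x by (simp add: u_def f_def G.m_assoc cancel)
    show ?thesis
      unfolding p_mult[OF uU[OF xC[OF C]] fs[OF C], symmetric]
        p_mult[OF fr[OF C] uU[OF C], symmetric] eq ..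
  qed
  let ?U = "finprod ?A (\<lambda>C. p (u C)) ?L"
  have "?U = finprod ?A (\<lambda>C. p (u C)) ((\<lambda>C. x <#\<^bsub>G\<^esub> C) ` ?L)"
    using G.bij_lcoset_translate[OF U x] by (simp add: bij_betw_def)
  also have "\<dots> = finprod ?A (\<lambda>C. p (u (x <#\<^bsub>G\<^esub> C))) ?L"
    by (rule A.finprod_reindex)
      (use G.bij_lcoset_translate[OF U x] xC uU p_closed in \<open>auto simp: bij_betw_def\<close>)
  finally have "?U \<otimes>\<^bsub>?A\<^esub> finprod ?A (\<lambda>C. p (f s C)) ?L
      = finprod ?A (\<lambda>C. p (u (x <#\<^bsub>G\<^esub> C)) \<otimes>\<^bsub>?A\<^esub> p (f s C)) ?L"
    by (subst A.finprod_multf) (use xC uU fs p_closed in auto)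
  also have "\<dots> = finprod ?A (\<lambda>C. p (f r C) \<otimes>\<^bsub>?A\<^esub> p (u C)) ?L"
    by (rule A.finprod_cong') (use rel uU fr p_closed in \<open>auto simp del: mult_FactGroup\<close>)
  also have "\<dots> = finprod ?A (\<lambda>C. p (f r C)) ?L \<otimes>\<^bsub>?A\<^esub> ?U"
    by (rule A.finprod_multf) (use uU fr p_closed in auto)
  also have "\<dots> = ?U \<otimes>\<^bsub>?A\<^esub> finprod ?A (\<lambda>C. p (f r C)) ?L"
    by (rule A.m_comm) (use uU fr p_closed in auto)
  finally have "finprod ?A (\<lambda>C. p (f s C)) ?L = finprod ?A (\<lambda>C. p (f r C)) ?L"
    by (subst (asm) p.H.Units_l_cancel) (use uU fr fs p_closed in \<open>auto simp: p.H.Units_eq\<close>)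
  then show ?thesis
    by (simp add: section_transfer_def p_def f_def)
qed

lemma exists_left_transversal:
  assumes "Gf_obj G U"
  shows "\<exists>l. left_transversal G U l"
proof -
  let ?n = "lindex G U"
  obtain b where b: "bij_betw b {1..?n} (lcosets\<^bsub>G\<^esub> U)"
    using ex_bij_betw_nat_finite_1 assms by (auto simp: Gf_obj_def)
  have "\<forall>i\<in>{1..?n}. \<exists>a\<in>carrier G. b i = a <#\<^bsub>G\<^esub> U"
    using bij_betwE[OF b] by (fastforce simp: LCOSETS_def)
  then obtain l where l: "\<And>i. i \<in> {1..?n} \<Longrightarrow> l i \<in> carrier G \<and> b i = l i <#\<^bsub>G\<^esub> U"
    by metis
  have "bij_betw (\<lambda>i. l i <#\<^bsub>G\<^esub> U) {1..?n} (lcosets\<^bsub>G\<^esub> U)"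
    using b l by (subst bij_betw_cong[where g = b]) auto
  then have "left_transversal G U l"
    using l by (auto simp: left_transversal_def)
  then show ?thesis
    by blast
qed

lemma transversal_perm:
  assumes "group G" "subgroup U G" and l: "left_transversal G U l" and x: "x \<in> carrier G"
    and i: "i \<in> {1..lindex G U}"
  shows "transversal_perm G U l x i \<in> {1..lindex G U}"
    and "(x \<otimes>\<^bsub>G\<^esub> l i) <#\<^bsub>G\<^esub> U = l (transversal_perm G U l x i) <#\<^bsub>G\<^esub> U"
proof -
  interpret G: group G by fact
  have lG: "l i \<in> carrier G" and b: "bij_betw (\<lambda>i. l i <#\<^bsub>G\<^esub> U) {1..lindex G U} (lcosets\<^bsub>G\<^esub> U)"
    using l i by (auto simp: left_transversal_def)
  have "(x \<otimes>\<^bsub>G\<^esub> l i) <#\<^bsub>G\<^esub> U \<in> lcosets\<^bsub>G\<^esub> U"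
    using x lG by (auto simp: LCOSETS_def)
  from bij_betw_imp_surj_on[OF b, symmetric] this
  obtain j where "j \<in> {1..lindex G U}" "(x \<otimes>\<^bsub>G\<^esub> l i) <#\<^bsub>G\<^esub> U = l j <#\<^bsub>G\<^esub> U"
    by blast
  then have "\<exists>!j. j \<in> {1..lindex G U} \<and> (x \<otimes>\<^bsub>G\<^esub> l i) <#\<^bsub>G\<^esub> U = l j <#\<^bsub>G\<^esub> U"
    using inj_onD[OF bij_betw_imp_inj_on[OF b]] by (intro ex1I[of _ j]) auto
  from theI'[OF this] show "transversal_perm G U l x i \<in> {1..lindex G U}"
    and "(x \<otimes>\<^bsub>G\<^esub> l i) <#\<^bsub>G\<^esub> U = l (transversal_perm G U l x i) <#\<^bsub>G\<^esub> U"
    by (auto simp: transversal_perm_def)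
qed

text \<open>Keeping the product in \<open>U\<close> instead of its class modulo \<open>U'\<close> allows homomorphisms to be applied
  to it, and leaving the list of indices variable allows induction.\<close>

definition transfer_product ::
  "('a, 'm) monoid_scheme \<Rightarrow> 'a set \<Rightarrow> (nat \<Rightarrow> 'a) \<Rightarrow> 'a \<Rightarrow> nat list \<Rightarrow> 'a" where
  "transfer_product G U l x is =
     foldr (\<lambda>i y. (inv\<^bsub>G\<^esub> (l (transversal_perm G U l x i)) \<otimes>\<^bsub>G\<^esub> x \<otimes>\<^bsub>G\<^esub> l i) \<otimes>\<^bsub>G\<^esub> y)
       is \<one>\<^bsub>G\<^esub>"

lemma transfer_wrt_eq:
  "transfer_wrt G U l x =
     sub_derived G U #>\<^bsub>sub_group G U\<^esub> transfer_product G U l x [1..<Suc (lindex G U)]"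
  by (simp add: transfer_wrt_def transfer_product_def)

lemma transfer_product_Cons:
  "transfer_product G U l x (i # is) =
     (inv\<^bsub>G\<^esub> (l (transversal_perm G U l x i)) \<otimes>\<^bsub>G\<^esub> x \<otimes>\<^bsub>G\<^esub> l i) \<otimes>\<^bsub>G\<^esub> transfer_product G U l x is"
  by (simp add: transfer_product_def)

lemma factor_in_subgroup:
  assumes G: "group G" and U: "subgroup U G" and l: "left_transversal G U l"
    and x: "x \<in> carrier G" and i: "i \<in> {1..lindex G U}"
  shows "inv\<^bsub>G\<^esub> (l (transversal_perm G U l x i)) \<otimes>\<^bsub>G\<^esub> x \<otimes>\<^bsub>G\<^esub> l i \<in> U"
proof -
  interpret G: group G by fact
  let ?j = "transversal_perm G U l x i"
  note j = transversal_perm[OF G U l x i]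
  have car: "l i \<in> carrier G" "l ?j \<in> carrier G"
    using l i j(1) by (auto simp: left_transversal_def)
  have "x \<otimes>\<^bsub>G\<^esub> l i \<in> (x \<otimes>\<^bsub>G\<^esub> l i) <#\<^bsub>G\<^esub> U" "l ?j \<in> l ?j <#\<^bsub>G\<^esub> U"
    using car x U by (auto intro: G.lcos_self)
  then have "inv\<^bsub>G\<^esub> (l ?j) \<otimes>\<^bsub>G\<^esub> (x \<otimes>\<^bsub>G\<^esub> l i) \<in> U"
    using j(2) car by (intro G.lcoset_quotient[OF U, of "l ?j <#\<^bsub>G\<^esub> U"]) (auto simp: LCOSETS_def)
  then show ?thesis
    using car x by (simp add: G.m_assoc)
qed

lemma transfer_product_closed:
  assumes "group G" "subgroup U G" "left_transversal G U l" "x \<in> carrier G"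
    and "set is \<subseteq> {1..lindex G U}"
  shows "transfer_product G U l x is \<in> U"
  using assms(5)
proof (induction "is")
  case Nil
  then show ?case
    using assms by (simp add: transfer_product_def subgroup.one_closed)
next
  case (Cons i "is")
  then have "inv\<^bsub>G\<^esub> (l (transversal_perm G U l x i)) \<otimes>\<^bsub>G\<^esub> x \<otimes>\<^bsub>G\<^esub> l i \<in> U"
    using assms by (intro factor_in_subgroup) auto
  then show ?case
    using Cons assms by (simp add: transfer_product_Cons subgroup.m_closed)
qed

text \<open>The defining relation of \<open>\<lambda>\<^sub>x\<close> says that \<open>r\<close> takes the value \<open>l (\<lambda>\<^sub>x i)\<close> at the translated coset
  \<open>x l\<^sub>i U\<close>. So the two products have the same factors, reindexed by the bijection \<open>i \<mapsto> l\<^sub>i U\<close>, and their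
  order is immaterial in \<open>U/U'\<close>.\<close>

lemma transfer_wrt_eq_section_transfer:
  assumes G: "group G" and U: "subgroup U G" and l: "left_transversal G U l"
    and x: "x \<in> carrier G"
    and r: "\<And>i. i \<in> {1..lindex G U} \<Longrightarrow> r (l i <#\<^bsub>G\<^esub> U) = l i"
  shows "transfer_wrt G U l x = section_transfer G U r x"
proof -
  interpret G: group G by fact
  let ?A = "abelianization G U" and ?N = "{1..lindex G U}"
  define p where "p = (\<lambda>u. sub_derived G U #>\<^bsub>sub_group G U\<^esub> u)"
  interpret p: group_hom "sub_group G U" ?A p
    unfolding p_def by (rule hom_to_abelianization) fact+
  interpret A: comm_group ?A
    by (rule hom_to_abelianization) fact+
  define f where "f i = inv\<^bsub>G\<^esub> (l (transversal_perm G U l x i)) \<otimes>\<^bsub>G\<^esub> x \<otimes>\<^bsub>G\<^esub> l i" for i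
  have fU: "f i \<in> U" if "i \<in> ?N" for i
    unfolding f_def using factor_in_subgroup[OF G U l x that] .
  have pf: "p (f i) \<in> carrier ?A" if "i \<in> ?N" for i
    using p.hom_closed[of "f i"] fU[OF that] by simp
  have list: "p (transfer_product G U l x is) = finprod ?A (\<lambda>i. p (f i)) (set is)"
    if "set is \<subseteq> ?N" "distinct is" for "is"
    using that
  proof (induction "is")
    case Nil
    then show ?case
      using p.hom_one by (simp add: transfer_product_def)
  next
    case (Cons i "is")
    have "p (transfer_product G U l x (i # is))
        = p (f i) \<otimes>\<^bsub>?A\<^esub> p (transfer_product G U l x is)"
      using p.hom_mult[of "f i" "transfer_product G U l x is"] fU Cons.prems
        transfer_product_closed[OF G U l x, of "is"]
      by (simp add: transfer_product_Cons f_def)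
    also have "\<dots> = finprod ?A (\<lambda>i. p (f i)) (set (i # is))"
    proof -
      have "finprod ?A (\<lambda>i. p (f i)) (insert i (set is))
          = p (f i) \<otimes>\<^bsub>?A\<^esub> finprod ?A (\<lambda>i. p (f i)) (set is)"
        by (rule A.finprod_insert) (use Cons.prems pf in auto)
      then show ?thesis
        using Cons by simp
    qed
    finally show ?case .
  qed
  have "transfer_wrt G U l x = finprod ?A (\<lambda>i. p (f i)) (set [1..<Suc (lindex G U)])"
    unfolding transfer_wrt_eq by (subst list[symmetric]) (auto simp: p_def)
  also have "set [1..<Suc (lindex G U)] = ?N"
    by auto
  also have "finprod ?A (\<lambda>i. p (f i)) ?N = section_transfer G U r x"
  proof -
    define F where "F C = p (inv\<^bsub>G\<^esub> r (x <#\<^bsub>G\<^esub> C) \<otimes>\<^bsub>G\<^esub> x \<otimes>\<^bsub>G\<^esub> r C)" for C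
    have b: "bij_betw (\<lambda>i. l i <#\<^bsub>G\<^esub> U) ?N (lcosets\<^bsub>G\<^esub> U)"
      using l by (simp add: left_transversal_def)
    have F: "F (l i <#\<^bsub>G\<^esub> U) = p (f i)" if i: "i \<in> ?N" for i
    proof -
      note j = transversal_perm[OF G U l x i]
      have "l i \<in> carrier G"
        using l i by (auto simp: left_transversal_def)
      then show ?thesis
        using r[OF i] r[OF j(1)] j(2) x U by (simp add: F_def f_def G.lcoset_translate)
    qed
    have "finprod ?A (\<lambda>i. p (f i)) ?N = finprod ?A (\<lambda>i. F (l i <#\<^bsub>G\<^esub> U)) ?N"
      by (rule A.finprod_cong') (use F pf in auto)
    also have "\<dots> = finprod ?A F ((\<lambda>i. l i <#\<^bsub>G\<^esub> U) ` ?N)"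
      by (rule A.finprod_reindex[symmetric]) (use F pf bij_betw_imp_inj_on[OF b] in auto)
    also have "\<dots> = section_transfer G U r x"
      unfolding bij_betw_imp_surj_on[OF b] section_transfer_def F_def p_def ..
    finally show ?thesis .
  qed
  finally show ?thesis .
qed

lemma transfer_wrt_unique:
  assumes G: "group G" and U: "subgroup U G" and x: "x \<in> carrier G"
    and l: "left_transversal G U l" and k: "left_transversal G U k"
  shows "transfer_wrt G U l x = transfer_wrt G U k x"
proof -
  let ?N = "{1..lindex G U}"
  \<comment> \<open>The section belonging to a transversal: look up the index of the coset.\<close>
  define r where "r l = (\<lambda>C. l (inv_into ?N (\<lambda>i. l i <#\<^bsub>G\<^esub> U) C))" for l :: "nat \<Rightarrow> 'a"
  have r: "r l (l i <#\<^bsub>G\<^esub> U) = l i" if "left_transversal G U l" "i \<in> ?N" for l i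
    using that(1) bij_betw_inv_into_left[OF _ that(2), of "\<lambda>i. l i <#\<^bsub>G\<^esub> U"]
    by (auto simp: r_def left_transversal_def)
  have sec: "r l C \<in> C" if l: "left_transversal G U l" and C: "C \<in> lcosets\<^bsub>G\<^esub> U" for l C
  proof -
    obtain i where i: "i \<in> ?N" "C = l i <#\<^bsub>G\<^esub> U"
      using l C unfolding left_transversal_def bij_betw_def by blast
    moreover have "l i \<in> carrier G"
      using l i by (auto simp: left_transversal_def)
    ultimately show ?thesis
      using r[OF l] group.lcos_self[OF G _ U] by simp
  qed
  have "section_transfer G U (r l) x = section_transfer G U (r k) x"
    by (rule section_transfer_unique[OF G U x]) (use sec l k in auto)
  then show ?thesis
    using transfer_wrt_eq_section_transfer[OF G U l x r[OF l]]
      transfer_wrt_eq_section_transfer[OF G U k x r[OF k]] by simp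
qed

lemma transfer_kernel_iff:
  assumes obj: "Gf_obj G U" and l: "left_transversal G U l" and x: "x \<in> carrier G"
  shows "x \<in> transfer_kernel G U \<longleftrightarrow>
     transfer_product G U l x [1..<Suc (lindex G U)] \<in> sub_derived G U"
proof -
  have G: "group G" and U: "subgroup U G"
    using obj by (auto simp: Gf_obj_def)
  have "left_transversal G U (SOME l. left_transversal G U l)"
    using exists_left_transversal[OF obj] by (rule someI_ex)
  then have "artin_transfer G U x = transfer_wrt G U l x"
    using transfer_wrt_unique[OF G U x _ l] by (simp add: artin_transfer_def)
  moreover have "transfer_product G U l x [1..<Suc (lindex G U)] \<in> U"
    by (rule transfer_product_closed[OF G U l x]) auto
  ultimately show ?thesis
    using x kernel_to_abelianization[OF G U]
    by (simp add: transfer_kernel_def kernel_def transfer_wrt_eq)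
qed

section \<open>Isomorphisms carry transfer kernels onto each other\<close>

lemma image_lcoset:
  assumes "\<phi> \<in> hom G H" "subgroup U G" "a \<in> carrier G"
  shows "\<phi> ` (a <#\<^bsub>G\<^esub> U) = \<phi> a <#\<^bsub>H\<^esub> \<phi> ` U"
  using hom_mult[OF assms(1,3)] subgroup.mem_carrier[OF assms(2)]
  by (auto simp: l_coset_def image_UN)

lemma iso_lcosets:
  assumes iso: "\<phi> \<in> iso G H" and G: "group G" and U: "subgroup U G"
  shows "bij_betw (image \<phi>) (lcosets\<^bsub>G\<^esub> U) (lcosets\<^bsub>H\<^esub> (\<phi> ` U))"
proof -
  have hom: "\<phi> \<in> hom G H" and inj: "inj_on \<phi> (carrier G)" and sur: "\<phi> ` carrier G = carrier H"
    using iso by (auto simp: iso_def bij_betw_def)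
  have "inj_on (image \<phi>) (lcosets\<^bsub>G\<^esub> U)"
    using inj_on_image_Pow[OF inj] group.lcosets_subset_PowG[OF G U] by (rule inj_on_subset)
  moreover have "image \<phi> ` (lcosets\<^bsub>G\<^esub> U) = lcosets\<^bsub>H\<^esub> (\<phi> ` U)"
    using image_lcoset[OF hom U] by (auto simp: LCOSETS_def sur[symmetric] image_UN)
  ultimately show ?thesis
    by (simp add: bij_betw_def)
qed

lemma iso_left_transversal:
  assumes iso: "\<phi> \<in> iso G H" and G: "group G" and U: "subgroup U G"
    and l: "left_transversal G U l"
  shows "left_transversal H (\<phi> ` U) (\<phi> \<circ> l)" and "lindex H (\<phi> ` U) = lindex G U"
proof -
  have hom: "\<phi> \<in> hom G H"
    using iso by (auto simp: iso_def)
  show n: "lindex H (\<phi> ` U) = lindex G U"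
    using bij_betw_same_card[OF iso_lcosets[OF iso G U]] by simp
  have lG: "l i \<in> carrier G" if "i \<in> {1..lindex G U}" for i
    using l that by (auto simp: left_transversal_def)
  have "bij_betw (image \<phi> \<circ> (\<lambda>i. l i <#\<^bsub>G\<^esub> U)) {1..lindex G U} (lcosets\<^bsub>H\<^esub> (\<phi> ` U))"
    using l iso_lcosets[OF iso G U] by (auto simp: left_transversal_def intro: bij_betw_trans)
  then have "bij_betw (\<lambda>i. \<phi> (l i) <#\<^bsub>H\<^esub> \<phi> ` U) {1..lindex G U} (lcosets\<^bsub>H\<^esub> (\<phi> ` U))"
    by (rule bij_betw_cong[THEN iffD1, rotated]) (use image_lcoset[OF hom U] lG in simp)
  then show "left_transversal H (\<phi> ` U) (\<phi> \<circ> l)"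
    using lG hom by (auto simp: left_transversal_def n hom_def)
qed

lemma iso_transversal_perm:
  assumes iso: "\<phi> \<in> iso G H" and G: "group G" and U: "subgroup U G"
    and l: "left_transversal G U l" and x: "x \<in> carrier G" and i: "i \<in> {1..lindex G U}"
  shows "transversal_perm H (\<phi> ` U) (\<phi> \<circ> l) (\<phi> x) i = transversal_perm G U l x i"
proof -
  interpret G: group G by fact
  have hom: "\<phi> \<in> hom G H"
    using iso by (auto simp: iso_def)
  have inj: "inj_on (image \<phi>) (lcosets\<^bsub>G\<^esub> U)"
    using iso_lcosets[OF iso G U] by (simp add: bij_betw_def)
  have lG: "l i \<in> carrier G" if "i \<in> {1..lindex G U}" for i
    using l that by (auto simp: left_transversal_def)
  have "(\<phi> x \<otimes>\<^bsub>H\<^esub> (\<phi> \<circ> l) i) <#\<^bsub>H\<^esub> \<phi> ` U = (\<phi> \<circ> l) j <#\<^bsub>H\<^esub> \<phi> ` U \<longleftrightarrow>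
      (x \<otimes>\<^bsub>G\<^esub> l i) <#\<^bsub>G\<^esub> U = l j <#\<^bsub>G\<^esub> U" if j: "j \<in> {1..lindex G U}" for j
  proof -
    have "(\<phi> x \<otimes>\<^bsub>H\<^esub> (\<phi> \<circ> l) i) <#\<^bsub>H\<^esub> \<phi> ` U = \<phi> ` ((x \<otimes>\<^bsub>G\<^esub> l i) <#\<^bsub>G\<^esub> U)"
      using image_lcoset[OF hom U] hom_mult[OF hom] x lG[OF i] by simp
    moreover have "(\<phi> \<circ> l) j <#\<^bsub>H\<^esub> \<phi> ` U = \<phi> ` (l j <#\<^bsub>G\<^esub> U)"
      using image_lcoset[OF hom U lG[OF j]] by simp
    ultimately show ?thesis
      using inj_on_eq_iff[OF inj, of "(x \<otimes>\<^bsub>G\<^esub> l i) <#\<^bsub>G\<^esub> U" "l j <#\<^bsub>G\<^esub> U"] x lG[OF i] lG[OF j]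
      by (auto simp: LCOSETS_def)
  qed
  then show ?thesis
    unfolding transversal_perm_def iso_left_transversal(2)[OF iso G U l]
    by (intro arg_cong[where f = The] ext) blast
qed

lemma iso_transfer_product:
  assumes iso: "\<phi> \<in> iso G H" and G: "group G" and H: "group H" and U: "subgroup U G"
    and l: "left_transversal G U l" and x: "x \<in> carrier G" and "set is \<subseteq> {1..lindex G U}"
  shows "transfer_product H (\<phi> ` U) (\<phi> \<circ> l) (\<phi> x) is = \<phi> (transfer_product G U l x is)"
  using assms(7)
proof (induction "is")
  case Nil
  then show ?case
    using iso hom_one[OF _ G H] by (auto simp: transfer_product_def iso_def)
next
  case (Cons i "is")
  interpret group_hom G H \<phi>
    using iso G H by (auto simp: group_hom_def group_hom_axioms_def iso_def)
  let ?j = "transversal_perm G U l x i"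
  have i: "i \<in> {1..lindex G U}"
    using Cons.prems by simp
  have "l i \<in> carrier G" "l ?j \<in> carrier G"
    using l i transversal_perm(1)[OF G U l x i] by (auto simp: left_transversal_def)
  moreover have "transfer_product G U l x is \<in> carrier G"
    using transfer_product_closed[OF G U l x, of "is"] Cons.prems subgroup.mem_carrier[OF U]
    by simp
  ultimately show ?case
    using Cons iso_transversal_perm[OF iso G U l x i] x
    by (simp add: transfer_product_Cons o_def)
qed

text \<open>The image of a transversal under an isomorphism is a transversal inducing the same
  permutations, so the transfer products correspond; as \<open>\<phi>\<close> carries \<open>U'\<close> onto \<open>V'\<close>, so do the
  kernels. The transversals chosen in the definitions for the two pairs need not correspond under
  \<open>\<phi>\<close>, whence the need for independence of the transversal.\<close>

lemma iso_transfer_kernel: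
  assumes iso: "\<phi> \<in> iso G H" and GU: "Gf_obj G U" and HV: "Gf_obj H V" and V: "\<phi> ` U = V"
  shows "\<phi> ` transfer_kernel G U = transfer_kernel H V"
proof -
  have G: "group G" and U: "subgroup U G" and H: "group H" and VH: "subgroup (\<phi> ` U) H"
    using GU HV V by (auto simp: Gf_obj_def)
  have hom: "\<phi> \<in> hom G H" and inj: "inj_on \<phi> (carrier G)" and sur: "\<phi> ` carrier G = carrier H"
    using iso by (auto simp: iso_def bij_betw_def)
  obtain l where l: "left_transversal G U l"
    using exists_left_transversal[OF GU] by blast
  have k: "left_transversal H V (\<phi> \<circ> l)" and n: "lindex H V = lindex G U"
    using iso_left_transversal[OF iso G U l] V by auto
  have derU: "sub_derived G U \<subseteq> U"
    using group.derived_in_carrier[OF group.subgroup_imp_group[OF G U], of U] by simp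
  have iff: "\<phi> x \<in> transfer_kernel H V \<longleftrightarrow> x \<in> transfer_kernel G U" if x: "x \<in> carrier G" for x
  proof -
    let ?z = "transfer_product G U l x [1..<Suc (lindex G U)]"
    have \<phi>x: "\<phi> x \<in> carrier H"
      using x sur by blast
    have z: "?z \<in> U"
      by (rule transfer_product_closed[OF G U l x]) auto
    have "\<phi> x \<in> transfer_kernel H V \<longleftrightarrow>
        transfer_product H V (\<phi> \<circ> l) (\<phi> x) [1..<Suc (lindex G U)] \<in> sub_derived H V"
      using transfer_kernel_iff[OF HV k \<phi>x] by (simp only: n)
    also have "transfer_product H V (\<phi> \<circ> l) (\<phi> x) [1..<Suc (lindex G U)] = \<phi> ?z"
      using iso_transfer_product[OF iso G H U l x, of "[1..<Suc (lindex G U)]"] V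
      by (simp add: atLeastLessThanSuc_atLeastAtMost del: upt_Suc)
    also have "sub_derived H V = \<phi> ` sub_derived G U"
      using image_sub_derived[OF hom G H U VH] V by simp
    also have "\<phi> ?z \<in> \<phi> ` sub_derived G U \<longleftrightarrow> ?z \<in> sub_derived G U"
      using z derU subgroup.subset[OF U] by (intro inj_on_image_mem_iff[OF inj]) auto
    also have "\<dots> \<longleftrightarrow> x \<in> transfer_kernel G U"
      using transfer_kernel_iff[OF GU l x] by simp
    finally show ?thesis .
  qed
  have "transfer_kernel G U \<subseteq> carrier G" "transfer_kernel H V \<subseteq> \<phi> ` carrier G"
    using sur by (auto simp: transfer_kernel_def kernel_def)
  then show ?thesis
    using iff by blast
qed

section \<open>The partial order\<close>

lemma tk_prec_refl:
  assumes "Gf_obj G U"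
  shows "tk_prec G U G U"
proof -
  have "kernel G G id \<subseteq> U"
    using assms by (auto simp: Gf_obj_def kernel_def subgroup.one_closed)
  then have "Gf_mor G U G U id"
    using assms by (auto simp: Gf_mor_def epi_def hom_def)
  then show ?thesis
    unfolding tk_prec_def by (intro exI[of _ id]) simp
qed

lemma Gf_mor_compose:
  assumes \<phi>: "Gf_mor G U H V \<phi>" and \<psi>: "Gf_mor H V K W \<psi>"
  shows "Gf_mor G U K W (\<psi> \<circ> \<phi>)"
proof -
  have objs: "group G" "subgroup U G" "group H" "group K"
    using \<phi> \<psi> by (auto simp: Gf_mor_def Gf_obj_def)
  interpret group_hom G H \<phi>
    using \<phi> objs by (auto simp: Gf_mor_def epi_def group_hom_def group_hom_axioms_def)
  have "x \<in> U" if x: "x \<in> carrier G" "\<psi> (\<phi> x) = \<one>\<^bsub>K\<^esub>" for x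
  proof -
    have "\<phi> x \<in> \<phi> ` U"
      using x \<phi> \<psi> by (auto simp: Gf_mor_def kernel_def)
    then obtain u where u: "u \<in> U" "\<phi> x = \<phi> u"
      by blast
    have uG: "u \<in> carrier G"
      using u objs by (simp add: subgroup.mem_carrier)
    have "x \<otimes>\<^bsub>G\<^esub> inv\<^bsub>G\<^esub> u \<in> kernel G H \<phi>"
      using x u uG by (simp add: kernel_def)
    then have "x \<otimes>\<^bsub>G\<^esub> inv\<^bsub>G\<^esub> u \<in> U"
      using \<phi> by (auto simp: Gf_mor_def)
    then have "(x \<otimes>\<^bsub>G\<^esub> inv\<^bsub>G\<^esub> u) \<otimes>\<^bsub>G\<^esub> u \<in> U"
      using u objs by (simp add: subgroup.m_closed)
    then show ?thesis
      using x uG by (simp add: G.m_assoc)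
  qed
  moreover have "\<psi> \<circ> \<phi> \<in> epi G K"
    using \<phi> \<psi> by (auto simp: Gf_mor_def intro: epi_compose)
  moreover have "(\<psi> \<circ> \<phi>) ` U = W"
    using \<phi> \<psi> by (auto simp: Gf_mor_def image_comp [symmetric])
  ultimately show ?thesis
    using \<phi> \<psi> by (auto simp: Gf_mor_def kernel_def)
qed

lemma tk_prec_trans:
  assumes "tk_prec G U H V" "tk_prec H V K W"
  shows "tk_prec G U K W"
proof -
  obtain \<phi> \<psi> where \<phi>: "Gf_mor G U H V \<phi>" "\<phi> ` transfer_kernel G U \<subseteq> transfer_kernel H V"
    and \<psi>: "Gf_mor H V K W \<psi>" "\<psi> ` transfer_kernel H V \<subseteq> transfer_kernel K W"
    using assms by (auto simp: tk_prec_def)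
  have "(\<psi> \<circ> \<phi>) ` transfer_kernel G U \<subseteq> transfer_kernel K W"
    using \<phi>(2) \<psi>(2) by auto
  then show ?thesis
    using Gf_mor_compose[OF \<phi>(1) \<psi>(1)] unfolding tk_prec_def by blast
qed

text \<open>Morphisms in both directions compose to an epimorphism \<open>G \<rightarrow> G\<close>, which is an isomorphism by
  the Hopf property; hence the first of them is injective.\<close>

lemma Gf_mor_hopfian_iso:
  assumes "hopfian G" and \<phi>: "Gf_mor G U H V \<phi>" and \<psi>: "Gf_mor H V G U \<psi>"
  shows "\<phi> \<in> iso G H"
proof -
  have "\<psi> \<circ> \<phi> \<in> epi G G"
    using Gf_mor_compose[OF \<phi> \<psi>] by (simp add: Gf_mor_def)
  then have "\<psi> \<circ> \<phi> \<in> iso G G"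
    using \<open>hopfian G\<close> by (auto simp: hopfian_def)
  then show ?thesis
    using \<phi> \<psi> epi_iso_compose_rev[of \<phi> G H \<psi> G] by (auto simp: Gf_mor_def epi_def)
qed

lemma tk_prec_antisym:
  assumes "hopfian G" "tk_prec G U H V" "tk_prec H V G U"
  shows "tk_equal G U H V"
proof -
  obtain \<phi> \<psi> where \<phi>: "Gf_mor G U H V \<phi>" and \<psi>: "Gf_mor H V G U \<psi>"
    using assms by (auto simp: tk_prec_def)
  have iso: "\<phi> \<in> iso G H"
    using \<open>hopfian G\<close> \<phi> \<psi> by (rule Gf_mor_hopfian_iso)
  have "\<phi> ` transfer_kernel G U = transfer_kernel H V"
    using iso_transfer_kernel[OF iso] \<phi> by (simp add: Gf_mor_def)
  moreover have "induced G U H V \<phi> \<in> iso (abelianization G U) (abelianization H V)"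
    using induced_iso[OF iso] \<phi> by (simp add: Gf_mor_def Gf_obj_def)
  ultimately show ?thesis
    using \<phi> by (auto simp: tk_equal_def)
qed

theorem corollary5p2:
  fixes G :: "('a, 'm) monoid_scheme" and U :: "'a set"
    and H :: "('b, 'n) monoid_scheme" and V :: "'b set"
    and K :: "('c, 'k) monoid_scheme" and W :: "'c set"
  shows "(hopfian_obj G U \<longrightarrow> tk_prec G U G U) \<and>
    (hopfian_obj G U \<and> hopfian_obj H V \<and> hopfian_obj K W \<longrightarrow>
       tk_prec G U H V \<longrightarrow> tk_prec H V K W \<longrightarrow> tk_prec G U K W) \<and>
    (hopfian_obj G U \<and> hopfian_obj H V \<longrightarrow>
       tk_prec G U H V \<longrightarrow> tk_prec H V G U \<longrightarrow> tk_equal G U H V)"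
proof (intro conjI impI)
  show "tk_prec G U G U" if "hopfian_obj G U"
    using that by (simp add: hopfian_obj_def tk_prec_refl)
  show "tk_prec G U K W" if "tk_prec G U H V" "tk_prec H V K W"
    using that by (rule tk_prec_trans)
  show "tk_equal G U H V"
    if "hopfian_obj G U \<and> hopfian_obj H V" "tk_prec G U H V" "tk_prec H V G U"
    using that by (intro tk_prec_antisym) (simp_all add: hopfian_obj_def)
qed

end
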